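(* Let $(L,[p])$ be a finite-dimensional restricted Leibniz algebra over a field $\mathbb{F}$ of prime characteristic $p$. Suppose that $L$ has decompositions into direct sums of $p$-ideals $$L=M_1\oplus M_2\oplus\cdots\oplus M_s,\qquad L=N_1\oplus N_2\oplus\cdots\oplus N_t,$$ where none of $M_1,\dots,M_s$ and $N_1,\dots,N_t$ can be decomposed into a direct sum of $p$-ideals. If $Z(L)=0$, then $s=t$ and, after changing the order, $M_i=N_i$ for $i=1,2,\dots,s$.
   Context: A (left) Leibniz algebra over $\mathbb{F}$ is an $\mathbb{F}$-vector space $L$ with a bilinear bracket satisfying $[[x,y],z]=[x,[y,z]]-[y,[x,z]]$ for all $x,y,z\in L$; $L_a(x)=[a,x]$ denotes left multiplication. A restricted Leibniz algebra $(L,[p])$ is a Leibniz algebra $L$ with a $p$-mapping $[p]:L\to L$, $a\mapsto a^{[p]}$, i.e. a mapping such that for all $a,b\in L$, $\alpha\in\mathbb{F}$: (i) $L_{a^{[p]}}=(L_a)^p$; (ii) $(\alpha a)^{[p]}=\alpha^pa^{[p]}$; (iii) $(a+b)^{[p]}=a^{[p]}+b^{[p]}+\sum_{i=1}^{p-1}s_i(a,b)$, where $(L(a\otimes X+b\otimes1))^{p-1}(a\otimes 1)=\sum_{i=1}^{p-1}i\,s_i(a,b)\otimes X^{i-1}$ in $L\otimes_{\mathbb{F}}\mathbb{F}[X]$ (with bracket $[a\otimes f,b\otimes g]=[a,b]\otimes fg$, and $L(u)$ denoting left multiplication by $u$). An ideal of $L$ is a subspace $H$ with $[L,H]\subseteq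 H$ and $[H,L]\subseteq H$; a $p$-ideal is an ideal $H$ with $x^{[p]}\in H$ for all $x\in H$. $Z(L)=\{x\in L\mid[x,L]=0\}$. A $p$-ideal $M$ "cannot be decomposed into a direct sum of $p$-ideals" if $M\neq 0$ and $M$ (with the restricted $p$-mapping) is not the direct sum of two nonzero $p$-ideals of $M$. *)

theory Defs
  imports
    "HOL-Computational_Algebra.Polynomial"
    "HOL-Computational_Algebra.Primes"
    "HOL-Combinatorics.Permutations"
    "HOL-Library.FuncSet"
begin

locale leibniz_algebra = vector_space scale
  for scale :: "'f::field \<Rightarrow> 'a::ab_group_add \<Rightarrow> 'a" (infixr \<open>*s\<close> 75) +
  fixes br :: "'a \<Rightarrow> 'a \<Rightarrow> 'a"
  assumes linear_right: "Vector_Spaces.linear scale scale (\<lambda>y. br x y)"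
    and linear_left: "Vector_Spaces.linear scale scale (\<lambda>x. br x y)"
    and leibniz: "br (br x y) z = br x (br y z) - br y (br x z)"

text \<open>
  The space \<open>L \<otimes> F[X]\<close> is represented by \<^typ>\<open>'a poly\<close>, the polynomials with coefficients in
  \<open>L\<close>; the pure tensor \<open>a \<otimes> f\<close> is the polynomial whose coefficients are those of \<open>f\<close> applied
  to \<open>a\<close>. The bracket is characterised by \<open>[a \<otimes> f, b \<otimes> g] = [a, b] \<otimes> fg\<close>, see
  \<open>poly_bracket_tensor\<close> below.
\<close>

definition tensor :: "('f::field \<Rightarrow> 'a::ab_group_add \<Rightarrow> 'a) \<Rightarrow> 'a \<Rightarrow> 'f poly \<Rightarrow> 'a poly" where
  "tensor scale a f = (\<Sum>i\<le>degree f. monom (scale (coeff f i) a) i)"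

definition poly_bracket ::
  "('a::ab_group_add \<Rightarrow> 'a \<Rightarrow> 'a) \<Rightarrow> 'a poly \<Rightarrow> 'a poly \<Rightarrow> 'a poly" where
  "poly_bracket br u v =
     (\<Sum>i\<le>degree u. \<Sum>j\<le>degree v. monom (br (coeff u i) (coeff v j)) (i + j))"

lemma (in vector_space) coeff_tensor: "coeff (tensor scale a f) n = scale (coeff f n) a"
proof -
  have "coeff (tensor scale a f) n
      = (\<Sum>i\<le>degree f. if i = n then scale (coeff f n) a else 0)"
    unfolding tensor_def coeff_sum by (intro sum.cong) auto
  then show ?thesis
    by (cases "n \<le> degree f") (simp_all add: coeff_eq_0)
qed

lemma (in leibniz_algebra) br_zero [simp]: "br 0 y = 0" "br x 0 = 0"
  using module_hom.zero[OF Vector_Spaces.linear.axioms(3)[OF linear_left]]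
    module_hom.zero[OF Vector_Spaces.linear.axioms(3)[OF linear_right]] by auto

lemma (in leibniz_algebra) coeff_poly_bracket:
  "coeff (poly_bracket br u v) n = (\<Sum>i\<le>n. br (coeff u i) (coeff v (n - i)))"
proof -
  have inner: "(\<Sum>j\<le>degree v. coeff (monom (br (coeff u i) (coeff v j)) (i + j)) n)
      = (if i \<le> n then br (coeff u i) (coeff v (n - i)) else 0)" for i
  proof (cases "i \<le> n")
    case True
    have "(\<Sum>j\<le>degree v. coeff (monom (br (coeff u i) (coeff v j)) (i + j)) n)
       = (\<Sum>j\<le>degree v. if j = n - i then br (coeff u i) (coeff v (n - i)) else 0)"
      using True by (intro sum.cong) auto
    then show ?thesis
      using True by (cases "n - i \<le> degree v") (simp_all add: coeff_eq_0)
  qed (auto intro!: sum.neutral)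
  have "coeff (poly_bracket br u v) n
      = (\<Sum>i\<le>degree u. if i \<le> n then br (coeff u i) (coeff v (n - i)) else 0)"
    unfolding poly_bracket_def coeff_sum inner ..
  also have "\<dots> = (\<Sum>i\<in>{..degree u} \<inter> {..n}. br (coeff u i) (coeff v (n - i)))"
    by (simp add: sum.inter_restrict del: Int_atMost)
  also have "\<dots> = (\<Sum>i\<le>n. br (coeff u i) (coeff v (n - i)))"
  proof (rule sum.mono_neutral_left)
    show "\<forall>i\<in>{..n} - {..degree u} \<inter> {..n}. br (coeff u i) (coeff v (n - i)) = 0"
    proof
      fix i assume "i \<in> {..n} - {..degree u} \<inter> {..n}"
      then have "coeff u i = 0" by (intro coeff_eq_0) auto
      then show "br (coeff u i) (coeff v (n - i)) = 0" by simp
    qed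
  qed auto
  finally show ?thesis .
qed

lemma (in leibniz_algebra) poly_bracket_tensor:
  "poly_bracket br (tensor scale a f) (tensor scale b g) = tensor scale (br a b) (f * g)"
proof (rule poly_eqI)
  fix n
  have "br (c *s x) (d *s y) = (c * d) *s br x y" for c d x y
    using module_hom.scale[OF Vector_Spaces.linear.axioms(3)[OF linear_left], of c x]
      module_hom.scale[OF Vector_Spaces.linear.axioms(3)[OF linear_right]] by simp
  then show "coeff (poly_bracket br (tensor scale a f) (tensor scale b g)) n
      = coeff (tensor scale (br a b) (f * g)) n"
    by (simp add: coeff_poly_bracket coeff_tensor coeff_mult scale_sum_left)
qed

text \<open>
  \<open>s_terms scale br p a b s\<close> says that \<open>s 1, \<dots>, s (p - 1)\<close> are the elements \<open>s\<^sub>i(a, b)\<close> determined by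
  \<open>(L(a \<otimes> X + b \<otimes> 1))\<^sup>p\<^sup>-\<^sup>1 (a \<otimes> 1) = \<Sum>i = 1..p - 1. i s\<^sub>i(a, b) \<otimes> X\<^sup>i\<^sup>-\<^sup>1\<close>.
  In characteristic \<open>p\<close> these values are unique if they exist. The left-hand side also has an
  \<open>X\<^sup>p\<^sup>-\<^sup>1\<close>-coefficient, \<open>(L\<^sub>a)\<^sup>p\<^sup>-\<^sup>1(a)\<close>, and the equation includes that it vanishes.
\<close>

definition s_terms ::
  "('f::field \<Rightarrow> 'a::ab_group_add \<Rightarrow> 'a) \<Rightarrow> ('a \<Rightarrow> 'a \<Rightarrow> 'a) \<Rightarrow> nat \<Rightarrow> 'a \<Rightarrow> 'a \<Rightarrow> (nat \<Rightarrow> 'a) \<Rightarrow> bool" where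
  "s_terms scale br p a b s \<longleftrightarrow>
     (poly_bracket br (tensor scale a (monom 1 1) + tensor scale b 1) ^^ (p - 1)) (tensor scale a 1)
     = (\<Sum>i = 1..p - 1. tensor scale (scale (of_nat i) (s i)) (monom 1 (i - 1)))"

locale restricted_leibniz_algebra = leibniz_algebra scale br
  for scale :: "'f::field \<Rightarrow> 'a::ab_group_add \<Rightarrow> 'a" (infixr \<open>*s\<close> 75)
    and br :: "'a \<Rightarrow> 'a \<Rightarrow> 'a" +
  fixes p :: nat and pmap :: "'a \<Rightarrow> 'a"
  assumes prime_p: "prime p"
    and char_p: "CHAR('f) = p"
    and pmap_left_mult: "br (pmap a) = br a ^^ p"
    and pmap_scale: "pmap (\<alpha> *s a) = (\<alpha> ^ p) *s pmap a"
    and pmap_add: "\<exists>s. s_terms scale br p a b s \<and>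
                     pmap (a + b) = pmap a + pmap b + (\<Sum>i = 1..p - 1. s i)"

text \<open>
  \<open>p_ideal scale br pmap M H\<close>: \<open>H\<close> is a \<open>p\<close>-ideal of the restricted Leibniz algebra carried by
  \<open>M\<close> (with the bracket and \<open>p\<close>-mapping restricted to \<open>M\<close>); \<open>M = UNIV\<close> gives the \<open>p\<close>-ideals of
  \<open>L\<close> itself.
\<close>

definition p_ideal ::
  "('f::field \<Rightarrow> 'a::ab_group_add \<Rightarrow> 'a) \<Rightarrow> ('a \<Rightarrow> 'a \<Rightarrow> 'a) \<Rightarrow> ('a \<Rightarrow> 'a) \<Rightarrow> 'a set \<Rightarrow> 'a set \<Rightarrow> bool" where
  "p_ideal scale br pmap M H \<longleftrightarrow>
     H \<subseteq> M \<and> module.subspace scale H \<and>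
     (\<forall>x\<in>M. \<forall>h\<in>H. br x h \<in> H \<and> br h x \<in> H) \<and>
     (\<forall>h\<in>H. pmap h \<in> H)"

definition left_center :: "('a::ab_group_add \<Rightarrow> 'a \<Rightarrow> 'a) \<Rightarrow> 'a set" where
  "left_center br = {x. \<forall>y. br x y = 0}"

text \<open>Every element of \<open>V\<close> is uniquely a sum of elements of the \<open>M i\<close>, and all such sums lie in \<open>V\<close>.\<close>

definition is_direct_sum :: "'a::ab_group_add set \<Rightarrow> 'i set \<Rightarrow> ('i \<Rightarrow> 'a set) \<Rightarrow> bool" where
  "is_direct_sum V I M \<longleftrightarrow> bij_betw (\<lambda>m. \<Sum>i\<in>I. m i) (Pi\<^sub>E I M) V"

definition p_indecomposable ::
  "('f::field \<Rightarrow> 'a::ab_group_add \<Rightarrow> 'a) \<Rightarrow> ('a \<Rightarrow> 'a \<Rightarrow> 'a) \<Rightarrow> ('a \<Rightarrow> 'a) \<Rightarrow> 'a set \<Rightarrow> bool" where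
  "p_indecomposable scale br pmap M \<longleftrightarrow>
     M \<noteq> {0} \<and>
     \<not> (\<exists>A B. p_ideal scale br pmap M A \<and> p_ideal scale br pmap M B \<and>
            A \<noteq> {0} \<and> B \<noteq> {0} \<and> bij_betw (\<lambda>(a, b). a + b) (A \<times> B) M)"

end

theory Submission
  imports Defs
begin

text \<open>
  A direct decomposition \<open>L = A \<oplus> A'\<close> into ideals splits the bracket as well, because
  \<open>[A, A']\<close> and \<open>[A', A]\<close> lie in \<open>A \<inter> A' = 0\<close>. If the left center vanishes, an element is
  determined by its left multiplication, and this makes any two such decompositions compatible:
  for \<open>L = A \<oplus> A' = B \<oplus> B'\<close>, the \<open>A\<close>-component of an element of \<open>B\<close> lies again in \<open>B\<close>
  (\<open>component_mem\<close>), so that \<open>B = (B \<inter> A) \<oplus> (B \<inter> A')\<close>. To see this, write the \<open>A\<close>-component of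
  \<open>x \<in> B\<close> as \<open>b + b'\<close>; every product \<open>[b', z]\<close> lies in \<open>B'\<close>, and it can be rewritten as a
  product \<open>[x, c]\<close>, which lies in \<open>B\<close>. Hence \<open>[b', L] = 0\<close> and \<open>b' = 0\<close>.

  The same hypothesis forces \<open>A'\<close> to be the annihilator of \<open>A\<close>, and the annihilator is closed under
  the \<open>p\<close>-mapping, because left multiplication by the image of \<open>a\<close> is the \<open>p\<close>-th iterate of left
  multiplication by \<open>a\<close> (\<open>p_ideal_complement\<close>). So the splitting of \<open>B\<close> above is
  one into \<open>p\<close>-ideals, and an indecomposable \<open>B\<close> lies in \<open>A\<close> or in \<open>A'\<close>
  (\<open>indecomposable_subset_cases\<close>).

  Now let \<open>A\<close> run through the summands \<open>M\<^sub>i\<close>, with \<open>A'\<close> the sum of the other ones, and let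
  \<open>B = N\<^sub>j\<close>. The complements \<open>A'\<close> have intersection \<open>0\<close>, whence \<open>N\<^sub>j \<subseteq> M\<^sub>i\<close> for some \<open>i\<close>. By
  symmetry \<open>M\<^sub>i \<subseteq> N\<^sub>k\<close> for some \<open>k\<close>. Distinct nonzero summands of one decomposition are not
  contained in each other, so \<open>k = j\<close> and \<open>N\<^sub>j = M\<^sub>i\<close>; the two families therefore consist of the
  same ideals.
\<close>

section \<open>Decompositions into two ideals\<close>

context leibniz_algebra
begin

lemma br_add_left: "br (x + y) z = br x z + br y z"
  using module_hom.add[OF Vector_Spaces.linear.axioms(3)[OF linear_left]] .

lemma br_add_right: "br x (y + z) = br x y + br x z"
  using module_hom.add[OF Vector_Spaces.linear.axioms(3)[OF linear_right]] .

lemma br_sum_left: "br (\<Sum>i\<in>I. f i) z = (\<Sum>i\<in>I. br (f i) z)"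
  by (induction I rule: infinite_finite_induct) (simp_all add: br_add_left)

lemma br_sum_right: "br x (\<Sum>i\<in>I. f i) = (\<Sum>i\<in>I. br x (f i))"
  by (induction I rule: infinite_finite_induct) (simp_all add: br_add_right)

definition ideal :: "'a set \<Rightarrow> bool" where
  "ideal H \<longleftrightarrow> subspace H \<and> (\<forall>x. \<forall>h\<in>H. br x h \<in> H \<and> br h x \<in> H)"

lemma p_ideal_UNIV_iff: "p_ideal scale br pmap UNIV H \<longleftrightarrow> ideal H \<and> (\<forall>h\<in>H. pmap h \<in> H)"
  by (auto simp: p_ideal_def ideal_def)

definition ideal_split :: "'a set \<Rightarrow> 'a set \<Rightarrow> bool" where
  "ideal_split A A' \<longleftrightarrow>
     ideal A \<and> ideal A' \<and> A \<inter> A' = {0} \<and> (\<forall>x. \<exists>a\<in>A. \<exists>a'\<in>A'. x = a + a')"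

lemma ideal_splitE:
  assumes "ideal_split A A'"
  obtains a a' where "a \<in> A" "a' \<in> A'" "x = a + a'"
  using assms unfolding ideal_split_def by blast

lemma ideal_split_br_eq_0:
  assumes "ideal_split A A'" "a \<in> A" "a' \<in> A'"
  shows "br a a' = 0" "br a' a = 0"
  using assms unfolding ideal_split_def ideal_def by blast+

text \<open>
  The obstruction \<open>b'\<close>, the \<open>B'\<close>-component of \<open>a\<close>, multiplies everything from the left into both
  \<open>B\<close> and \<open>B'\<close>. It therefore lies in the left center.
\<close>

lemma component_mem:
  assumes center: "left_center br = {0}"
    and A: "ideal_split A A'" and B: "ideal_split B B'"
    and a: "a \<in> A" "a' \<in> A'" and x: "a + a' \<in> B"
  shows "a \<in> B"
proof -
  obtain b b' where b: "b \<in> B" "b' \<in> B'" "a = b + b'"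
    using B by (rule ideal_splitE)
  have "br b' z = 0" for z
  proof -
    obtain w w' where w: "w \<in> B" "w' \<in> B'" "z = w + w'"
      using B by (rule ideal_splitE)
    obtain c c' where c: "c \<in> A" "c' \<in> A'" "w' = c + c'"
      using A by (rule ideal_splitE)
    (* Only the B'-part of z and then only the A-part of that contribute. *)
    have "br b' z = br b' w'"
      using ideal_split_br_eq_0[OF B w(1) b(2)] by (simp add: w br_add_right)
    also have "\<dots> = br a w'"
      using ideal_split_br_eq_0[OF B b(1) w(2)] by (simp add: b br_add_left)
    also have "\<dots> = br a c"
      using ideal_split_br_eq_0[OF A a(1) c(2)] by (simp add: c br_add_right)
    also have "\<dots> = br (a + a') c"
      using ideal_split_br_eq_0[OF A c(1) a(2)] by (simp add: br_add_left)
    finally have "br b' z = br (a + a') c" .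
    moreover have "br (a + a') c \<in> B" and "br b' z \<in> B'"
      using B x b(2) unfolding ideal_split_def ideal_def by blast+
    ultimately show ?thesis
      using B unfolding ideal_split_def by auto
  qed
  then have "b' = 0"
    using center unfolding left_center_def by blast
  with b show ?thesis by simp
qed

text \<open>
  For \<open>x = a + a'\<close> with \<open>[x, A] = 0\<close> also \<open>[a, A] = 0\<close>, while \<open>[a, A'] = 0\<close> holds anyway; so \<open>a\<close>
  is central. The point of this description of \<open>A'\<close> is that it mentions only left multiplications,
  which are what the \<open>p\<close>-mapping is related to.
\<close>

lemma complement_eq_annihilator:
  assumes center: "left_center br = {0}" and A: "ideal_split A A'"
  shows "A' = {x. \<forall>y\<in>A. br x y = 0}"
proof (intro equalityI subsetI CollectI ballI)
  fix x assume "x \<in> {x. \<forall>y\<in>A. br x y = 0}"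
  then have ann: "br x y = 0" if "y \<in> A" for y using that by blast
  obtain a a' where a: "a \<in> A" "a' \<in> A'" "x = a + a'"
    using A by (rule ideal_splitE)
  have "br a z = 0" for z
  proof -
    obtain c c' where c: "c \<in> A" "c' \<in> A'" "z = c + c'"
      using A by (rule ideal_splitE)
    have "br a z = br a c"
      using ideal_split_br_eq_0[OF A a(1) c(2)] by (simp add: c br_add_right)
    also have "\<dots> = br x c"
      using ideal_split_br_eq_0[OF A c(1) a(2)] by (simp add: a br_add_left)
    finally show ?thesis using ann c(1) by simp
  qed
  then have "a = 0"
    using center unfolding left_center_def by blast
  with a show "x \<in> A'" by simp
qed (rule ideal_split_br_eq_0(2)[OF A])

end

context restricted_leibniz_algebra
begin

lemma p_ideal_complement:
  assumes center: "left_center br = {0}" and A: "ideal_split A A'"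
  shows "p_ideal scale br pmap UNIV A'"
proof -
  have "pmap x \<in> A'" if x: "x \<in> A'" for x
  proof -
    obtain k where k: "p = Suc k"
      using prime_p prime_gt_0_nat gr0_conv_Suc by blast
    have "br (pmap x) y = 0" if "y \<in> A" for y
    proof -
      have "br x y = 0"
        using ideal_split_br_eq_0(2)[OF A that x] .
      moreover have "(br x ^^ n) 0 = 0" for n
        by (induction n) simp_all
      ultimately show ?thesis
        by (simp add: pmap_left_mult k funpow_Suc_right del: funpow.simps)
    qed
    then show ?thesis
      using complement_eq_annihilator[OF center A] by blast
  qed
  then show ?thesis
    using A by (simp add: p_ideal_UNIV_iff ideal_split_def)
qed

lemma indecomposable_subset_cases:
  assumes center: "left_center br = {0}"
    and A: "ideal_split A A'" "p_ideal scale br pmap UNIV A"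
    and B: "ideal_split B B'" "p_ideal scale br pmap UNIV B"
    and indec: "p_indecomposable scale br pmap B"
  shows "B \<subseteq> A \<or> B \<subseteq> A'"
proof -
  have p_ideal_Int: "p_ideal scale br pmap B (B \<inter> H)" if "p_ideal scale br pmap UNIV H" for H
    using that B(2) subspace_inter unfolding p_ideal_def by auto
  have sub: "subspace A" "subspace A'" "subspace B" and AA': "A \<inter> A' = {0}"
    using A(1) B(1) by (auto simp: ideal_split_def ideal_def)
  have split: "\<exists>a\<in>B \<inter> A. \<exists>a'\<in>B \<inter> A'. x = a + a'" if "x \<in> B" for x
  proof -
    obtain a a' where a: "a \<in> A" "a' \<in> A'" "x = a + a'"
      using A(1) by (rule ideal_splitE)
    have "a \<in> B"
      using component_mem[OF center A(1) B(1) a(1,2)] that a(3) by simp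
    moreover have "a' = x - a" using a by simp
    then have "a' \<in> B" using subspace_diff[OF sub(3) that \<open>a \<in> B\<close>] by simp
    ultimately show ?thesis using a by blast
  qed
  have "inj_on (\<lambda>(a, b). a + b) ((B \<inter> A) \<times> (B \<inter> A'))"
  proof (rule inj_onI, clarsimp)
    fix a b c d
    assume "a \<in> A" "c \<in> A" "b \<in> A'" "d \<in> A'" and eq: "a + b = c + d"
    then have "a - c \<in> A" "d - b \<in> A'"
      using sub by (auto intro: subspace_diff)
    moreover have "a - c = d - b"
      using eq by (simp add: algebra_simps)
    ultimately have "a - c \<in> A \<inter> A'" by simp
    then have "a = c" using AA' by simp
    with eq show "a = c \<and> b = d" by simp
  qed
  moreover have "(\<lambda>(a, b). a + b) ` ((B \<inter> A) \<times> (B \<inter> A')) = B"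
    using split subspace_add[OF sub(3)] by fastforce
  ultimately have "bij_betw (\<lambda>(a, b). a + b) ((B \<inter> A) \<times> (B \<inter> A')) B"
    by (simp add: bij_betw_def)
  then have "B \<inter> A = {0} \<or> B \<inter> A' = {0}"
    using indec p_ideal_Int[OF A(2)] p_ideal_Int[OF p_ideal_complement[OF center A(1)]]
    unfolding p_indecomposable_def by blast
  then show ?thesis
  proof
    assume zero: "B \<inter> A = {0}"
    have "B \<subseteq> A'"
    proof
      fix x assume "x \<in> B"
      then obtain a a' where "a \<in> B \<inter> A" "a' \<in> B \<inter> A'" "x = a + a'"
        using split by blast
      then show "x \<in> A'" using zero by simp
    qed
    then show ?thesis ..
  next
    assume zero: "B \<inter> A' = {0}"
    have "B \<subseteq> A"
    proof
      fix x assume "x \<in> B"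
      then obtain a a' where "a \<in> B \<inter> A" "a' \<in> B \<inter> A'" "x = a + a'"
        using split by blast
      then show "x \<in> A" using zero by simp
    qed
    then show ?thesis ..
  qed
qed

end

section \<open>Complements of the summands in a family\<close>

text \<open>
  The sum of the summands other than \<open>M i\<close>, as the sums of families whose component at \<open>i\<close> is \<open>0\<close>.
  The families have the domain of \<^const>\<open>is_direct_sum\<close>, so that its uniqueness of components
  applies directly.
\<close>

definition cosummand :: "'i set \<Rightarrow> ('i \<Rightarrow> 'a::ab_group_add set) \<Rightarrow> 'i \<Rightarrow> 'a set" where
  "cosummand I M i = {\<Sum>l\<in>I. m l | m. m \<in> Pi\<^sub>E I M \<and> m i = 0}"

lemma direct_sum_unique:
  assumes "is_direct_sum V I M" "m \<in> Pi\<^sub>E I M" "n \<in> Pi\<^sub>E I M" "(\<Sum>l\<in>I. m l) = (\<Sum>l\<in>I. n l)"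
  shows "m = n"
  using assms unfolding is_direct_sum_def bij_betw_def inj_on_def by blast

lemma direct_sum_UNIV_obtain:
  assumes "is_direct_sum UNIV I M"
  obtains m where "m \<in> Pi\<^sub>E I M" "x = (\<Sum>l\<in>I. m l)"
proof -
  have "x \<in> (\<lambda>m. \<Sum>i\<in>I. m i) ` Pi\<^sub>E I M"
    using assms unfolding is_direct_sum_def bij_betw_def by simp
  then show thesis using that by blast
qed

text \<open>
  Lying in the cosummand at \<open>i\<close> means that the unique component at \<open>i\<close> vanishes. This is what
  prevents an indecomposable ideal from lying in all the complements.
\<close>

lemma cosummands_Int_trivial:
  assumes sum: "is_direct_sum UNIV I M" and x: "\<And>i. i \<in> I \<Longrightarrow> x \<in> cosummand I M i"
  shows "x = 0"
proof -
  obtain m where m: "m \<in> Pi\<^sub>E I M" "x = (\<Sum>l\<in>I. m l)"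
    using sum by (rule direct_sum_UNIV_obtain)
  have "m i = 0" if i: "i \<in> I" for i
  proof -
    obtain n where n: "n \<in> Pi\<^sub>E I M" "n i = 0" "x = (\<Sum>l\<in>I. n l)"
      using x[OF i] unfolding cosummand_def by blast
    then have "m = n" using direct_sum_unique[OF sum m(1) n(1)] m(2) by simp
    with n show ?thesis by simp
  qed
  then show ?thesis using m by simp
qed

context leibniz_algebra
begin

lemma sum_single_family:
  assumes "finite I" "i \<in> I" "x \<in> M i" "\<And>l. l \<in> I \<Longrightarrow> ideal (M l)"
  defines "n \<equiv> restrict (\<lambda>l. if l = i then x else 0) I"
  shows "n \<in> Pi\<^sub>E I M" "(\<Sum>l\<in>I. n l) = x"
proof -
  show "n \<in> Pi\<^sub>E I M"
    using assms by (auto simp: ideal_def subspace_0)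
  have "(\<Sum>l\<in>I. n l) = (\<Sum>l\<in>I. if l = i then x else 0)"
    by (intro sum.cong) (auto simp: n_def)
  then show "(\<Sum>l\<in>I. n l) = x"
    using assms by simp
qed

lemma summand_subset_cosummand:
  assumes "finite I" "i \<in> I" "l \<in> I" "i \<noteq> l" "\<And>l. l \<in> I \<Longrightarrow> ideal (M l)"
  shows "M l \<subseteq> cosummand I M i"
proof
  fix x assume "x \<in> M l"
  note single = sum_single_family[where M = M, OF assms(1,3) this assms(5)]
  then show "x \<in> cosummand I M i"
    using assms(2,4) unfolding cosummand_def
    by (intro CollectI exI[of _ "restrict (\<lambda>j. if j = l then x else 0) I"]) auto
qed

lemma ideal_cosummand:
  assumes I: "i \<in> I" and M: "\<And>l. l \<in> I \<Longrightarrow> ideal (M l)"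
  shows "ideal (cosummand I M i)"
proof -
  have sub: "subspace (M l)" if "l \<in> I" for l
    using M[OF that] by (simp add: ideal_def)
  (* Every operation is performed componentwise; restrict only corrects the values outside I. *)
  have memI: "(\<Sum>l\<in>I. f l) \<in> cosummand I M i" if "\<And>l. l \<in> I \<Longrightarrow> f l \<in> M l" "f i = 0" for f
    unfolding cosummand_def using that I
    by (intro CollectI exI[of _ "restrict f I"]) auto
  have memE: "\<exists>f. (\<forall>l\<in>I. f l \<in> M l) \<and> f i = 0 \<and> x = (\<Sum>l\<in>I. f l)"
    if "x \<in> cosummand I M i" for x
    using that unfolding cosummand_def by blast
  have "0 \<in> cosummand I M i"
    using memI[of "\<lambda>_. 0"] sub by (simp add: subspace_0)
  moreover have "x + y \<in> cosummand I M i"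
    if xy: "x \<in> cosummand I M i" "y \<in> cosummand I M i" for x y
  proof -
    obtain f g where "\<forall>l\<in>I. f l \<in> M l" "f i = 0" "x = (\<Sum>l\<in>I. f l)"
      and "\<forall>l\<in>I. g l \<in> M l" "g i = 0" "y = (\<Sum>l\<in>I. g l)"
      using memE xy by meson
    then show ?thesis
      using memI[of "\<lambda>l. f l + g l"] sub by (simp add: subspace_add sum.distrib)
  qed
  moreover have "c *s x \<in> cosummand I M i \<and> br y x \<in> cosummand I M i \<and> br x y \<in> cosummand I M i"
    if x: "x \<in> cosummand I M i" for c x y
  proof -
    obtain f where f: "\<forall>l\<in>I. f l \<in> M l" "f i = 0" "x = (\<Sum>l\<in>I. f l)"
      using memE[OF x] by blast
    have "c *s f l \<in> M l" "br y (f l) \<in> M l" "br (f l) y \<in> M l" if "l \<in> I" for l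
      using f(1) M[OF that] that by (auto simp: ideal_def subspace_scale)
    then show ?thesis
      using memI[of "\<lambda>l. c *s f l"] memI[of "\<lambda>l. br y (f l)"] memI[of "\<lambda>l. br (f l) y"] f
      by (simp add: scale_sum_right br_sum_left br_sum_right)
  qed
  ultimately show ?thesis
    unfolding ideal_def subspace_def by blast
qed

lemma ideal_split_cosummand:
  assumes I: "finite I" "i \<in> I" and M: "\<And>l. l \<in> I \<Longrightarrow> ideal (M l)"
    and sum: "is_direct_sum UNIV I M"
  shows "ideal_split (M i) (cosummand I M i)"
proof -
  have "x = 0" if x: "x \<in> M i" "x \<in> cosummand I M i" for x
  proof -
    obtain m where m: "m \<in> Pi\<^sub>E I M" "m i = 0" "x = (\<Sum>l\<in>I. m l)"
      using x(2) unfolding cosummand_def by blast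
    note single = sum_single_family[where M = M, OF I x(1) M]
    have "m = restrict (\<lambda>l. if l = i then x else 0) I"
      using direct_sum_unique[OF sum m(1) single(1)] single(2) m(3) by simp
    then have "m i = x" using I by simp
    with m show "x = 0" by simp
  qed
  moreover have "0 \<in> M i" "0 \<in> cosummand I M i"
    using M[OF I(2)] ideal_cosummand[OF I(2) M] by (simp_all add: ideal_def subspace_0)
  ultimately have "M i \<inter> cosummand I M i = {0}" by blast
  moreover have "\<exists>a\<in>M i. \<exists>a'\<in>cosummand I M i. x = a + a'" for x
  proof -
    obtain m where m: "m \<in> Pi\<^sub>E I M" "x = (\<Sum>l\<in>I. m l)"
      using sum by (rule direct_sum_UNIV_obtain)
    have "m(i := 0) \<in> Pi\<^sub>E I M"
      using m(1) I M by (auto simp: PiE_iff ideal_def subspace_0 extensional_def)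
    then have "(\<Sum>l\<in>I. (m(i := 0)) l) \<in> cosummand I M i"
      unfolding cosummand_def by (intro CollectI exI[of _ "m(i := 0)"]) simp
    moreover have "x = m i + (\<Sum>l\<in>I. (m(i := 0)) l)"
      using I m(2) by (simp add: sum.remove)
    moreover have "m i \<in> M i" using m(1) I by auto
    ultimately show ?thesis by blast
  qed
  ultimately show ?thesis
    using M[OF I(2)] ideal_cosummand[OF I(2) M] by (simp add: ideal_split_def)
qed

lemma summand_subset_imp_eq:
  assumes I: "finite I" "i \<in> I" "l \<in> I" and M: "\<And>l. l \<in> I \<Longrightarrow> ideal (M l)"
    and sum: "is_direct_sum UNIV I M" and "M l \<noteq> {0}" "M l \<subseteq> M i"
  shows "l = i"
proof (rule ccontr)
  assume "l \<noteq> i"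
  then have "M l \<subseteq> cosummand I M i"
    using summand_subset_cosummand[where M = M, OF I(1-3) _ M] by simp
  moreover have "M i \<inter> cosummand I M i = {0}"
    using ideal_split_cosummand[OF I(1,2) M sum] by (simp add: ideal_split_def)
  moreover have "0 \<in> M l"
    using M[OF I(3)] by (simp add: ideal_def subspace_0)
  ultimately show False using assms(6,7) by blast
qed

end

section \<open>Comparing two decompositions\<close>

context restricted_leibniz_algebra
begin

lemma indecomposable_subset_summand:
  assumes center: "left_center br = {0}"
    and I: "finite I" and M: "\<And>i. i \<in> I \<Longrightarrow> p_ideal scale br pmap UNIV (M i)"
    and sum: "is_direct_sum UNIV I M"
    and B: "ideal_split B B'" "p_ideal scale br pmap UNIV B" "p_indecomposable scale br pmap B"
  shows "\<exists>i\<in>I. B \<subseteq> M i"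
proof (rule ccontr)
  assume none: "\<not> (\<exists>i\<in>I. B \<subseteq> M i)"
  have ideal_M: "ideal (M i)" if "i \<in> I" for i
    using M[OF that] by (simp add: p_ideal_UNIV_iff)
  have "B \<subseteq> cosummand I M i" if "i \<in> I" for i
    using indecomposable_subset_cases[OF center ideal_split_cosummand[OF I that ideal_M sum]
        M[OF that] B] none that by blast
  then have "B \<subseteq> {0}"
    using cosummands_Int_trivial[OF sum] by blast
  moreover have "0 \<in> B"
    using B(1) by (simp add: ideal_split_def ideal_def subspace_0)
  ultimately show False
    using B(3) unfolding p_indecomposable_def by blast
qed

text \<open>
  The inclusions \<open>M i \<subseteq> N j \<subseteq> M l\<close> collapse, since nonzero summands of the same decomposition are
  comparable only if they have the same index.
\<close>

lemma summand_in_other_decomposition: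
  assumes center: "left_center br = {0}"
    and I: "finite I" "\<And>i. i \<in> I \<Longrightarrow> p_ideal scale br pmap UNIV (M i)"
      "is_direct_sum UNIV I M" "\<And>i. i \<in> I \<Longrightarrow> p_indecomposable scale br pmap (M i)"
    and J: "finite J" "\<And>j. j \<in> J \<Longrightarrow> p_ideal scale br pmap UNIV (N j)"
      "is_direct_sum UNIV J N" "\<And>j. j \<in> J \<Longrightarrow> p_indecomposable scale br pmap (N j)"
    and i: "i \<in> I"
  shows "\<exists>j\<in>J. M i = N j"
proof -
  have ideal_M: "ideal (M l)" if "l \<in> I" for l
    using I(2) that by (simp add: p_ideal_UNIV_iff)
  have ideal_N: "ideal (N k)" if "k \<in> J" for k
    using J(2) that by (simp add: p_ideal_UNIV_iff)
  obtain j where j: "j \<in> J" "M i \<subseteq> N j"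
    using indecomposable_subset_summand[OF center J(1-3)
        ideal_split_cosummand[OF I(1) i ideal_M I(3)] I(2)[OF i] I(4)[OF i]] by blast
  obtain l where l: "l \<in> I" "N j \<subseteq> M l"
    using indecomposable_subset_summand[OF center I(1-3)
        ideal_split_cosummand[OF J(1) j(1) ideal_N J(3)] J(2)[OF j(1)] J(4)[OF j(1)]] by blast
  have "M i \<noteq> {0}"
    using I(4)[OF i] by (simp add: p_indecomposable_def)
  then have "i = l"
    using summand_subset_imp_eq[OF I(1) l(1) i ideal_M I(3)] j l by blast
  with j l show ?thesis by blast
qed

lemma inj_on_indecomposable_summands:
  assumes I: "finite I" "\<And>i. i \<in> I \<Longrightarrow> p_ideal scale br pmap UNIV (M i)"
      "is_direct_sum UNIV I M" "\<And>i. i \<in> I \<Longrightarrow> p_indecomposable scale br pmap (M i)"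
  shows "inj_on M I"
proof (rule inj_onI)
  fix i l assume il: "i \<in> I" "l \<in> I" "M i = M l"
  have "ideal (M k)" if "k \<in> I" for k
    using I(2) that by (simp add: p_ideal_UNIV_iff)
  then show "i = l"
    using summand_subset_imp_eq[OF I(1) il(2,1) _ I(3)] I(4)[OF il(1)] il(3)
    by (simp add: p_indecomposable_def)
qed

end

theorem theorem6p9:
  fixes scale :: "'f::field \<Rightarrow> 'a::ab_group_add \<Rightarrow> 'a"
    and br :: "'a \<Rightarrow> 'a \<Rightarrow> 'a"
    and pmap :: "'a \<Rightarrow> 'a"
    and p s t :: nat
    and Basis :: "'a set"
    and M N :: "nat \<Rightarrow> 'a set"
  assumes "restricted_leibniz_algebra scale br p pmap"
    and "finite_dimensional_vector_space scale Basis"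
    and "\<And>i. i \<in> {1..s} \<Longrightarrow> p_ideal scale br pmap UNIV (M i)"
    and "\<And>j. j \<in> {1..t} \<Longrightarrow> p_ideal scale br pmap UNIV (N j)"
    and "is_direct_sum UNIV {1..s} M"
    and "is_direct_sum UNIV {1..t} N"
    and "\<And>i. i \<in> {1..s} \<Longrightarrow> p_indecomposable scale br pmap (M i)"
    and "\<And>j. j \<in> {1..t} \<Longrightarrow> p_indecomposable scale br pmap (N j)"
    and "left_center br = {0}"
  shows "s = t \<and> (\<exists>\<pi>. \<pi> permutes {1..s} \<and> (\<forall>i\<in>{1..s}. M i = N (\<pi> i)))"
proof -
  interpret restricted_leibniz_algebra scale br p pmap by (rule assms(1))
  note M = finite_atLeastAtMost[of 1 s] assms(3,5,7)
  note N = finite_atLeastAtMost[of 1 t] assms(4,6,8)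
  have inj_M: "inj_on M {1..s}" and inj_N: "inj_on N {1..t}"
    using inj_on_indecomposable_summands[OF M] inj_on_indecomposable_summands[OF N] by blast+
  have image: "M ` {1..s} = N ` {1..t}"
    using summand_in_other_decomposition[OF assms(9) M N]
      summand_in_other_decomposition[OF assms(9) N M] by blast
  then have "s = t"
    using card_image[OF inj_M] card_image[OF inj_N] by simp
  define f where "f = the_inv_into {1..t} N \<circ> M"
  have "bij_betw f {1..s} {1..t}"
    unfolding f_def
  proof (rule bij_betw_trans)
    show "bij_betw M {1..s} (N ` {1..t})"
      using inj_M image by (simp add: bij_betw_def)
    show "bij_betw (the_inv_into {1..t} N) (N ` {1..t}) {1..t}"
      using inj_N by (intro bij_betw_the_inv_into) (simp add: bij_betw_def)
  qed
  (* A permutation fixes everything outside its domain, so f has to be modified there. *)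
  define \<pi> where "\<pi> i = (if i \<in> {1..s} then f i else i)" for i
  have "bij_betw \<pi> {1..s} {1..s}"
    using \<open>bij_betw f {1..s} {1..t}\<close> \<open>s = t\<close>
    by (subst bij_betw_cong[of _ \<pi> f]) (auto simp: \<pi>_def)
  then have "\<pi> permutes {1..s}"
    by (rule bij_imp_permutes) (auto simp: \<pi>_def)
  moreover have "M i = N (\<pi> i)" if "i \<in> {1..s}" for i
  proof -
    have "M i \<in> N ` {1..t}" using image that by blast
    then have "N (f i) = M i"
      unfolding f_def comp_apply by (rule f_the_inv_into_f[OF inj_N])
    then show ?thesis
      using that by (simp add: \<pi>_def)
  qed
  ultimately show ?thesis using \<open>s = t\<close> by blast
qed

end
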